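(* Let $n\ge3$, and consider the Lie algebra $\mathfrak{m}_0(n)$ over $\mathbb{Z}_2$. The space $H^1(\mathfrak{m}_0(n))$ is spanned by the classes of the elements $e^1,e^2$, and $b_1(\mathfrak{m}_0(n))=2$. The space $H^2(\mathfrak{m}_0(n))$ is spanned by the classes of the elements $$e^{1n}\quad\text{and}\quad F(e^i,e^i)=e^{i,i+1}+e^{i-1,i+2}+\dots+e^{2,2i-1},\qquad 2\le i\le\tfrac12(n+1),$$ and $b_2(\mathfrak{m}_0(n))=\lfloor\frac12(n+1)\rfloor$.
   Context: $\mathfrak{m}_0(n)$ is the Lie algebra over $\mathbb{Z}_2$ with basis $e_1,\dots,e_n$ and brackets $[e_1,e_i]=e_{i+1}$ for $2\le i\le n-1$, all other brackets of basis elements (not following by antisymmetry) being zero. Let $e^i$ be the dual basis and $e^{i_1\dots i_q}=e^{i_1}\wedge\dots\wedge e^{i_q}$. The differential $d$ on the exterior algebra $\Lambda(\mathfrak{m}_0(n))$ is the derivation with $de^1=de^2=0$, $de^i=e^1\wedge e^{i-1}$ for $3\le i\le n$. $H^q(\mathfrak{m}_0(n))=\ker(d:\Lambda^q\to\Lambda^{q+1})/\mathrm{Im}(d:\Lambda^{q-1}\to\Lambda^q)$ and $b_q=\dim H^q$. In general $F(\omega,e^i)=\sum_{l\ge0}D^l\omega\wedge e^{i+1+l}$, where $D$ is the derivation of the exterior algebra on $e^2,e^3,\dots$ with $De^2=0$, $De^i=e^{i-1}$ for $i>2$; thus $F(e^i,e^i)=\sum_{l=0}^{i-2}e^{i-l,\,i+1+l}$.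 *)

theory Defs
  imports
    "Jordan_Normal_Form.VS_Connect"
    "HOL-Algebra.AbelCoset"
    "HOL-Library.Poly_Mapping"
    "HOL-Library.Z2"
begin


section \<open>Quotient modules\<close>

text \<open>
  The additive part is the additive factor group of the library; scalars act on a coset through
  its representatives, as in the library's \<open>rcoset_mult\<close>.  The \<open>mult\<close> and \<open>one\<close> fields of the
  record play no role in a module.
\<close>

definition quot_module :: "('a, 'b, 'm) module_scheme \<Rightarrow> 'b set \<Rightarrow> ('a, 'b set) module" where
  "quot_module M N =
    \<lparr> carrier = a_rcosets\<^bsub>M\<^esub> N, mult = (\<lambda>_ _. N), one = N, zero = N, add = set_add M,
      smult = (\<lambda>a C. \<Union>c\<in>C. N +>\<^bsub>M\<^esub> (a \<odot>\<^bsub>M\<^esub> c)) \<rparr>"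

lemma quot_module_module:
  assumes M: "Module.module R M" and sub: "N \<subseteq> carrier M" and zero: "\<zero>\<^bsub>M\<^esub> \<in> N"
    and addc: "\<And>x y. x \<in> N \<Longrightarrow> y \<in> N \<Longrightarrow> x \<oplus>\<^bsub>M\<^esub> y \<in> N"
    and sm: "\<And>a x. a \<in> carrier R \<Longrightarrow> x \<in> N \<Longrightarrow> a \<odot>\<^bsub>M\<^esub> x \<in> N"
  shows "Module.module R (quot_module M N)"
proof -
  interpret M: Module.module R M by (rule M)
  have invc: "\<ominus>\<^bsub>M\<^esub> x \<in> N" if "x \<in> N" for x
    using sm[OF _ that, of "\<ominus>\<^bsub>R\<^esub> \<one>\<^bsub>R\<^esub>"] that sub M.smult_l_minus[of "\<one>\<^bsub>R\<^esub>" x] by auto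
  have "subgroup N (add_monoid M)"
    using sub zero addc invc by unfold_locales (auto simp: a_inv_def)
  then interpret N: abelian_subgroup N M
    using M.abelian_group_axioms by (intro abelian_subgroupI3 additive_subgroup.intro)
  let ?Q = "quot_module M N"
  have car: "X \<in> carrier ?Q \<longleftrightarrow> (\<exists>x\<in>carrier M. X = N +>\<^bsub>M\<^esub> x)" for X
    by (auto simp: quot_module_def A_RCOSETS_defs a_r_coset_def r_coset_def)
  have ad: "(N +>\<^bsub>M\<^esub> x) \<oplus>\<^bsub>?Q\<^esub> (N +>\<^bsub>M\<^esub> y) = N +>\<^bsub>M\<^esub> (x \<oplus>\<^bsub>M\<^esub> y)"
    if "x \<in> carrier M" "y \<in> carrier M" for x y
    using that N.a_rcos_sum by (simp add: quot_module_def)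
  have zq: "\<zero>\<^bsub>?Q\<^esub> = N +>\<^bsub>M\<^esub> \<zero>\<^bsub>M\<^esub>"
    using sub by (simp add: quot_module_def M.a_coset_add_zero)
  have ag: "abelian_group ?Q"
  proof (rule abelian_groupI)
    fix X assume "X \<in> carrier ?Q"
    then obtain x where x: "x \<in> carrier M" "X = N +>\<^bsub>M\<^esub> x" unfolding car by blast
    then have "(N +>\<^bsub>M\<^esub> (\<ominus>\<^bsub>M\<^esub> x)) \<oplus>\<^bsub>?Q\<^esub> X = \<zero>\<^bsub>?Q\<^esub>"
      by (simp add: ad zq M.l_neg)
    moreover have "N +>\<^bsub>M\<^esub> (\<ominus>\<^bsub>M\<^esub> x) \<in> carrier ?Q"
      using M.a_inv_closed[OF x(1)] by (auto simp only: car)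
    ultimately show "\<exists>Y\<in>carrier ?Q. Y \<oplus>\<^bsub>?Q\<^esub> X = \<zero>\<^bsub>?Q\<^esub>"
      by (rule bexI)
  next
    fix X Y assume "X \<in> carrier ?Q" "Y \<in> carrier ?Q"
    then obtain x y where xy: "x \<in> carrier M" "X = N +>\<^bsub>M\<^esub> x" "y \<in> carrier M" "Y = N +>\<^bsub>M\<^esub> y"
      unfolding car by blast
    then show "X \<oplus>\<^bsub>?Q\<^esub> Y = Y \<oplus>\<^bsub>?Q\<^esub> X"
      by (simp add: ad M.a_comm)
    show "X \<oplus>\<^bsub>?Q\<^esub> Y \<in> carrier ?Q"
      using M.add.m_closed[OF xy(1,3)] by (auto simp only: car xy ad[OF xy(1,3)])
    fix W assume "W \<in> carrier ?Q"
    then obtain w where "w \<in> carrier M" "W = N +>\<^bsub>M\<^esub> w" unfolding car by blast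
    then show "X \<oplus>\<^bsub>?Q\<^esub> Y \<oplus>\<^bsub>?Q\<^esub> W = X \<oplus>\<^bsub>?Q\<^esub> (Y \<oplus>\<^bsub>?Q\<^esub> W)"
      using xy by (simp add: ad M.a_assoc)
  next
    show "\<zero>\<^bsub>?Q\<^esub> \<in> carrier ?Q"
      using M.zero_closed by (auto simp only: car zq)
  next
    fix X assume "X \<in> carrier ?Q"
    then obtain x where "x \<in> carrier M" "X = N +>\<^bsub>M\<^esub> x" unfolding car by blast
    then show "\<zero>\<^bsub>?Q\<^esub> \<oplus>\<^bsub>?Q\<^esub> X = X"
      by (simp add: zq ad)
  qed
  have smq: "a \<odot>\<^bsub>?Q\<^esub> (N +>\<^bsub>M\<^esub> x) = N +>\<^bsub>M\<^esub> (a \<odot>\<^bsub>M\<^esub> x)"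
    if a: "a \<in> carrier R" and x: "x \<in> carrier M" for a x
  proof -
    have "N +>\<^bsub>M\<^esub> (a \<odot>\<^bsub>M\<^esub> c) = N +>\<^bsub>M\<^esub> (a \<odot>\<^bsub>M\<^esub> x)" if c: "c \<in> N +>\<^bsub>M\<^esub> x" for c
    proof -
      obtain h where h: "h \<in> N" "c = h \<oplus>\<^bsub>M\<^esub> x"
        using c by (auto simp: a_r_coset_def r_coset_def)
      have "a \<odot>\<^bsub>M\<^esub> c = a \<odot>\<^bsub>M\<^esub> h \<oplus>\<^bsub>M\<^esub> a \<odot>\<^bsub>M\<^esub> x"
        using h a x sub by (auto simp: M.smult_r_distr)
      then have "a \<odot>\<^bsub>M\<^esub> c \<in> N +>\<^bsub>M\<^esub> (a \<odot>\<^bsub>M\<^esub> x)"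
        using sm[OF a h(1)] by (auto simp: a_r_coset_def r_coset_def)
      then show ?thesis
        using M.a_repr_independence[OF _ M.smult_closed[OF a x] N.a_subgroup] by simp
    qed
    moreover have "x \<in> N +>\<^bsub>M\<^esub> x"
      using x by (rule N.a_rcos_self)
    ultimately have "(\<Union>c\<in>N +>\<^bsub>M\<^esub> x. N +>\<^bsub>M\<^esub> (a \<odot>\<^bsub>M\<^esub> c)) = N +>\<^bsub>M\<^esub> (a \<odot>\<^bsub>M\<^esub> x)"
      by blast
    then show ?thesis
      by (simp add: quot_module_def)
  qed
  have carE: "\<exists>x. x \<in> carrier M \<and> X = N +>\<^bsub>M\<^esub> x" if "X \<in> carrier ?Q" for X
    using that car by blast
  show ?thesis
  proof (rule moduleI[OF M.R.is_cring ag])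
    fix a X assume "a \<in> carrier R" "X \<in> carrier ?Q"
    then show "a \<odot>\<^bsub>?Q\<^esub> X \<in> carrier ?Q"
      using M.smult_closed by (auto simp only: car smq)
  next
    fix a b X assume "a \<in> carrier R" "b \<in> carrier R" "X \<in> carrier ?Q"
    then show "(a \<oplus>\<^bsub>R\<^esub> b) \<odot>\<^bsub>?Q\<^esub> X = a \<odot>\<^bsub>?Q\<^esub> X \<oplus>\<^bsub>?Q\<^esub> b \<odot>\<^bsub>?Q\<^esub> X"
      by (auto dest!: carE simp: smq ad M.smult_l_distr)
  next
    fix a X Y assume "a \<in> carrier R" "X \<in> carrier ?Q" "Y \<in> carrier ?Q"
    then show "a \<odot>\<^bsub>?Q\<^esub> (X \<oplus>\<^bsub>?Q\<^esub> Y) = a \<odot>\<^bsub>?Q\<^esub> X \<oplus>\<^bsub>?Q\<^esub> a \<odot>\<^bsub>?Q\<^esub> Y"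
      by (auto dest!: carE simp: smq ad M.smult_r_distr)
  next
    fix a b X assume "a \<in> carrier R" "b \<in> carrier R" "X \<in> carrier ?Q"
    then show "(a \<otimes>\<^bsub>R\<^esub> b) \<odot>\<^bsub>?Q\<^esub> X = a \<odot>\<^bsub>?Q\<^esub> (b \<odot>\<^bsub>?Q\<^esub> X)"
      by (auto dest!: carE simp: smq M.smult_assoc1)
  next
    fix X assume "X \<in> carrier ?Q"
    then show "\<one>\<^bsub>R\<^esub> \<odot>\<^bsub>?Q\<^esub> X = X" by (auto dest!: carE simp: smq)
  qed
qed


section \<open>The exterior algebra over \<open>\<int>\<^sub>2\<close>\<close>

abbreviation Z2 :: "bit ring" where
  "Z2 \<equiv> class_ring"

text \<open>
  A form is a finite linear combination of monomials, and the monomial with indices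
  \<open>i < j < \<dots> < k\<close> is represented by the key \<open>{i, j, \<dots>, k}\<close>.  Since signs are trivial in
  characteristic 2, the product of the monomials with keys \<open>I\<close> and \<open>J\<close> is the monomial with key
  \<open>I \<union> J\<close> if \<open>I\<close> and \<open>J\<close> are disjoint, and \<open>0\<close> otherwise.  Infinite keys occur in the type but
  not in the spaces \<open>Lam n q\<close> defined below.
\<close>

abbreviation "lookup \<equiv> Poly_Mapping.lookup"
abbreviation "keys \<equiv> Poly_Mapping.keys"

type_synonym form = "nat set \<Rightarrow>\<^sub>0 bit"

abbreviation emon :: "nat set \<Rightarrow> form" where
  "emon I \<equiv> Poly_Mapping.single I 1"

definition e :: "nat \<Rightarrow> form" where
  "e i = emon {i}"

definition scal :: "bit \<Rightarrow> form \<Rightarrow> form" where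
  "scal c \<omega> = Poly_Mapping.map ((*) c) \<omega>"

definition wedge :: "form \<Rightarrow> form \<Rightarrow> form"  (infixl \<open>\<and>\<^sub>e\<close> 70) where
  "\<alpha> \<and>\<^sub>e \<beta> = (\<Sum>I\<in>keys \<alpha>. \<Sum>J\<in>keys \<beta>.
     if I \<inter> J = {} then Poly_Mapping.single (I \<union> J) (lookup \<alpha> I * lookup \<beta> J) else 0)"

text \<open>
  The derivation of the exterior algebra with prescribed values \<open>g i\<close> on the generators \<open>e i\<close>;
  see \<open>derivation_e\<close> and \<open>derivation_wedge\<close> below.
\<close>

definition derivation :: "(nat \<Rightarrow> form) \<Rightarrow> form \<Rightarrow> form" where
  "derivation g \<omega> = (\<Sum>I\<in>keys \<omega>. \<Sum>i\<in>I. scal (lookup \<omega> I) (g i \<and>\<^sub>e emon (I - {i})))"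

lemma lookup_scal [simp]: "lookup (scal c \<omega>) I = c * lookup \<omega> I"
  by (simp add: scal_def Poly_Mapping.map.rep_eq when_def)

lemma scal_0 [simp]: "scal 0 \<omega> = 0" and scal_1 [simp]: "scal 1 \<omega> = \<omega>"
  and scal_zero [simp]: "scal c 0 = 0"
  and scal_add: "scal c (\<alpha> + \<beta>) = scal c \<alpha> + scal c \<beta>"
  and scal_add_left: "scal (c + c') \<omega> = scal c \<omega> + scal c' \<omega>"
  and scal_scal: "scal (c * c') \<omega> = scal c (scal c' \<omega>)"
  by (auto intro!: poly_mapping_eqI simp: lookup_add algebra_simps)

lemma form_add_self [simp]: "\<omega> + \<omega> = (0 :: form)"
  by (rule poly_mapping_eqI) (simp add: lookup_add flip: mult_2)

lemma form_eq_sum: "\<omega> = (\<Sum>I\<in>keys \<omega>. emon I)" for \<omega> :: form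
proof (rule poly_mapping_eqI)
  fix I
  have "lookup (\<Sum>J\<in>keys \<omega>. emon J) I = (\<Sum>J\<in>keys \<omega>. if J = I then 1 else 0)"
    by (simp add: lookup_sum lookup_single when_def)
  also have "\<dots> = lookup \<omega> I"
    by (auto simp: in_keys_iff)
  finally show "lookup \<omega> I = lookup (\<Sum>J\<in>keys \<omega>. emon J) I" by simp
qed

lemma wedge_superset:
  assumes "finite A" "keys \<alpha> \<subseteq> A" "finite B" "keys \<beta> \<subseteq> B"
  shows "\<alpha> \<and>\<^sub>e \<beta> = (\<Sum>I\<in>A. \<Sum>J\<in>B.
     if I \<inter> J = {} then Poly_Mapping.single (I \<union> J) (lookup \<alpha> I * lookup \<beta> J) else 0)"
proof -
  have "\<alpha> \<and>\<^sub>e \<beta> = (\<Sum>I\<in>keys \<alpha>. \<Sum>J\<in>B.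
     if I \<inter> J = {} then Poly_Mapping.single (I \<union> J) (lookup \<alpha> I * lookup \<beta> J) else 0)"
    unfolding wedge_def using assms
    by (intro sum.cong sum.mono_neutral_left) (auto simp: in_keys_iff)
  also have "\<dots> = (\<Sum>I\<in>A. \<Sum>J\<in>B.
     if I \<inter> J = {} then Poly_Mapping.single (I \<union> J) (lookup \<alpha> I * lookup \<beta> J) else 0)"
    using assms by (intro sum.mono_neutral_left) (auto simp: in_keys_iff intro!: sum.neutral)
  finally show ?thesis .
qed

lemma wedge_0 [simp]: "0 \<and>\<^sub>e \<beta> = 0" "\<alpha> \<and>\<^sub>e 0 = 0"
  by (simp_all add: wedge_def)

lemma wedge_mono [simp]: "emon I \<and>\<^sub>e emon J = (if I \<inter> J = {} then emon (I \<union> J) else 0)"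
  by (simp add: wedge_def)

lemma wedge_commute: "\<alpha> \<and>\<^sub>e \<beta> = \<beta> \<and>\<^sub>e \<alpha>"
  unfolding wedge_def
  by (subst sum.swap, intro sum.cong refl) (auto simp: Un_commute Int_commute mult.commute)

lemma wedge_add_left: "(\<alpha> + \<alpha>') \<and>\<^sub>e \<beta> = \<alpha> \<and>\<^sub>e \<beta> + \<alpha>' \<and>\<^sub>e \<beta>"
proof -
  let ?A = "keys \<alpha> \<union> keys \<alpha>'"
  have *: "finite ?A" "keys (\<alpha> + \<alpha>') \<subseteq> ?A" "keys \<alpha> \<subseteq> ?A" "keys \<alpha>' \<subseteq> ?A"
    by (auto simp: Poly_Mapping.keys_add)
  show ?thesis
    by (simp only: wedge_superset[OF *(1,2) finite_keys subset_refl]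
        wedge_superset[OF *(1,3) finite_keys subset_refl]
        wedge_superset[OF *(1,4) finite_keys subset_refl]
        lookup_add distrib_right single_add flip: sum.distrib)
      (intro sum.cong refl, simp)
qed

lemma wedge_add_right: "\<beta> \<and>\<^sub>e (\<alpha> + \<alpha>') = \<beta> \<and>\<^sub>e \<alpha> + \<beta> \<and>\<^sub>e \<alpha>'"
  by (simp add: wedge_commute[of \<beta>] wedge_add_left)

lemma wedge_sum_left: "sum f A \<and>\<^sub>e \<beta> = (\<Sum>a\<in>A. f a \<and>\<^sub>e \<beta>)"
  by (induction A rule: infinite_finite_induct) (auto simp: wedge_add_left)

lemma wedge_sum_right: "\<beta> \<and>\<^sub>e sum f A = (\<Sum>a\<in>A. \<beta> \<and>\<^sub>e f a)"
  by (induction A rule: infinite_finite_induct) (auto simp: wedge_add_right)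

lemma wedge_assoc: "(\<alpha> \<and>\<^sub>e \<beta>) \<and>\<^sub>e \<gamma> = \<alpha> \<and>\<^sub>e (\<beta> \<and>\<^sub>e \<gamma>)"
proof -
  have *: "(emon I \<and>\<^sub>e emon J) \<and>\<^sub>e emon K = emon I \<and>\<^sub>e (emon J \<and>\<^sub>e emon K)" for I J K
    by (auto simp: Un_assoc)
  show ?thesis
    by (subst (1 2) form_eq_sum[of \<alpha>], subst (1 2) form_eq_sum[of \<beta>], subst (1 2) form_eq_sum[of \<gamma>])
      (simp only: wedge_sum_left wedge_sum_right *)
qed

lemma wedge_left_commute: "\<alpha> \<and>\<^sub>e (\<beta> \<and>\<^sub>e \<gamma>) = \<beta> \<and>\<^sub>e (\<alpha> \<and>\<^sub>e \<gamma>)"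
  by (metis wedge_assoc wedge_commute)

lemma wedge_e_self [simp]: "e i \<and>\<^sub>e e i = 0"
  by (simp add: e_def)

lemma derivation_0 [simp]: "derivation g 0 = 0"
  by (simp add: derivation_def)

lemma derivation_mono: "derivation g (emon I) = (\<Sum>i\<in>I. g i \<and>\<^sub>e emon (I - {i}))"
  by (simp add: derivation_def)

lemma wedge_mono_empty [simp]: "\<omega> \<and>\<^sub>e emon {} = \<omega>"
  by (subst (1 2) form_eq_sum[of \<omega>]) (simp add: wedge_sum_left)

lemma derivation_e [simp]: "derivation g (e i) = g i"
  by (simp add: e_def derivation_mono)

lemma derivation_add: "derivation g (\<alpha> + \<beta>) = derivation g \<alpha> + derivation g \<beta>"
proof -
  have *: "derivation g \<omega> = (\<Sum>I\<in>A. \<Sum>i\<in>I. scal (lookup \<omega> I) (g i \<and>\<^sub>e emon (I - {i})))"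
    if "finite A" "keys \<omega> \<subseteq> A" for A \<omega>
    unfolding derivation_def using that
    by (intro sum.mono_neutral_left) (auto simp: in_keys_iff)
  let ?A = "keys \<alpha> \<union> keys \<beta>"
  have "finite ?A" "keys (\<alpha> + \<beta>) \<subseteq> ?A" "keys \<alpha> \<subseteq> ?A" "keys \<beta> \<subseteq> ?A"
    by (auto simp: Poly_Mapping.keys_add)
  then show ?thesis
    by (simp only: * lookup_add scal_add_left sum.distrib)
qed

lemma derivation_sum: "derivation g (sum f A) = (\<Sum>a\<in>A. derivation g (f a))"
  by (induction A rule: infinite_finite_induct) (auto simp: derivation_add)

lemma derivation_wedge:
  assumes "\<And>I. I \<in> keys \<alpha> \<Longrightarrow> finite I" "\<And>J. J \<in> keys \<beta> \<Longrightarrow> finite J"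
  shows "derivation g (\<alpha> \<and>\<^sub>e \<beta>) = derivation g \<alpha> \<and>\<^sub>e \<beta> + \<alpha> \<and>\<^sub>e derivation g \<beta>"
proof -
  have *: "derivation g (emon I \<and>\<^sub>e emon J) = derivation g (emon I) \<and>\<^sub>e emon J + emon I \<and>\<^sub>e derivation g (emon J)"
    if fin: "finite I" "finite J" for I J
  proof -
    have L: "derivation g (emon I) \<and>\<^sub>e emon J
        = (\<Sum>i\<in>I. if (I - {i}) \<inter> J = {} then g i \<and>\<^sub>e emon ((I - {i}) \<union> J) else 0)"
      by (auto simp: derivation_mono wedge_sum_left wedge_assoc intro!: sum.cong)
    have R: "emon I \<and>\<^sub>e derivation g (emon J)
        = (\<Sum>i\<in>J. if I \<inter> (J - {i}) = {} then g i \<and>\<^sub>e emon (I \<union> (J - {i})) else 0)"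
      by (auto simp: derivation_mono wedge_sum_right wedge_left_commute[of "emon I"] intro!: sum.cong)
    show ?thesis
    proof (cases "I \<inter> J = {}")
      case True
      have "derivation g (emon (I \<union> J)) = (\<Sum>i\<in>I \<union> J. g i \<and>\<^sub>e emon (I \<union> J - {i}))"
        by (rule derivation_mono)
      also have "\<dots> = (\<Sum>i\<in>I. g i \<and>\<^sub>e emon (I \<union> J - {i})) + (\<Sum>i\<in>J. g i \<and>\<^sub>e emon (I \<union> J - {i}))"
        using True fin by (intro sum.union_disjoint)
      also have "(\<Sum>i\<in>I. g i \<and>\<^sub>e emon (I \<union> J - {i})) = derivation g (emon I) \<and>\<^sub>e emon J"
      proof -
        have "(I - {i}) \<inter> J = {} \<and> (I - {i}) \<union> J = I \<union> J - {i}" if "i \<in> I" for i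
          using that True by auto
        then show ?thesis unfolding L by (intro sum.cong) auto
      qed
      also have "(\<Sum>i\<in>J. g i \<and>\<^sub>e emon (I \<union> J - {i})) = emon I \<and>\<^sub>e derivation g (emon J)"
      proof -
        have "I \<inter> (J - {i}) = {} \<and> I \<union> (J - {i}) = I \<union> J - {i}" if "i \<in> J" for i
          using that True by auto
        then show ?thesis unfolding R by (intro sum.cong) auto
      qed
      finally show ?thesis using True by simp
    next
      case False
      let ?S = "\<Sum>i\<in>I \<inter> J. if I \<inter> J = {i} then g i \<and>\<^sub>e emon (I \<union> J) else 0"
      have "derivation g (emon I) \<and>\<^sub>e emon J = ?S"
      proof -
        have "(I - {i}) \<inter> J = {} \<longleftrightarrow> I \<inter> J = {i}" for i
          using False by auto
        moreover have "I \<inter> J = {i} \<Longrightarrow> (I - {i}) \<union> J = I \<union> J" for i by auto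
        ultimately have "derivation g (emon I) \<and>\<^sub>e emon J
            = (\<Sum>i\<in>I. if I \<inter> J = {i} then g i \<and>\<^sub>e emon (I \<union> J) else 0)"
          unfolding L by (intro sum.cong) auto
        also have "\<dots> = ?S"
          using fin by (intro sum.mono_neutral_right) auto
        finally show ?thesis .
      qed
      moreover have "emon I \<and>\<^sub>e derivation g (emon J) = ?S"
      proof -
        have "I \<inter> (J - {i}) = {} \<longleftrightarrow> I \<inter> J = {i}" for i
          using False by auto
        moreover have "I \<inter> J = {i} \<Longrightarrow> I \<union> (J - {i}) = I \<union> J" for i by auto
        ultimately have "emon I \<and>\<^sub>e derivation g (emon J)
            = (\<Sum>i\<in>J. if I \<inter> J = {i} then g i \<and>\<^sub>e emon (I \<union> J) else 0)"
          unfolding R by (intro sum.cong) auto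
        also have "\<dots> = ?S"
          using fin by (intro sum.mono_neutral_right) auto
        finally show ?thesis .
      qed
      ultimately show ?thesis using False by simp
    qed
  qed
  have "derivation g (\<alpha> \<and>\<^sub>e \<beta>)
      = (\<Sum>I\<in>keys \<alpha>. \<Sum>J\<in>keys \<beta>. derivation g (emon I \<and>\<^sub>e emon J))"
    unfolding derivation_sum[symmetric] wedge_sum_right[symmetric] wedge_sum_left[symmetric]
    by (simp flip: form_eq_sum)
  also have "\<dots> = (\<Sum>I\<in>keys \<alpha>. \<Sum>J\<in>keys \<beta>.
      derivation g (emon I) \<and>\<^sub>e emon J + emon I \<and>\<^sub>e derivation g (emon J))"
    using assms * by (intro sum.cong refl) auto
  also have "\<dots> = derivation g \<alpha> \<and>\<^sub>e \<beta> + \<alpha> \<and>\<^sub>e derivation g \<beta>"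
    unfolding sum.distrib derivation_sum[symmetric] wedge_sum_right[symmetric] wedge_sum_left[symmetric]
    by (simp flip: form_eq_sum)
  finally show ?thesis .
qed


section \<open>The Lie algebra \<open>\<mm>\<^sub>0(n)\<close> and its cochain complex\<close>

text \<open>
  Elements are coordinate vectors in the basis vectors \<open>bv 1, \<dots>, bv n\<close>.  The bracket is the
  bilinear extension of \<open>[bv 1, bv i] = [bv i, bv 1] = bv (i + 1)\<close> for \<open>2 \<le> i \<le> n - 1\<close>
  (recall \<open>-1 = 1\<close>), all other brackets of basis vectors being zero.
\<close>

definition m0 :: "nat \<Rightarrow> (nat \<Rightarrow>\<^sub>0 bit) set" where
  "m0 n = {x. keys x \<subseteq> {1..n}}"

abbreviation bv :: "nat \<Rightarrow> nat \<Rightarrow>\<^sub>0 bit" where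
  "bv i \<equiv> Poly_Mapping.single i 1"

definition bracket :: "nat \<Rightarrow> (nat \<Rightarrow>\<^sub>0 bit) \<Rightarrow> (nat \<Rightarrow>\<^sub>0 bit) \<Rightarrow> (nat \<Rightarrow>\<^sub>0 bit)" where
  "bracket n x y = (\<Sum>i\<in>{2..<n}.
     Poly_Mapping.single (i + 1) (lookup x 1 * lookup y i + lookup x i * lookup y 1))"

lemma lookup_bracket:
  "lookup (bracket n x y) k =
    (if 3 \<le> k \<and> k \<le> n then lookup x 1 * lookup y (k - 1) + lookup x (k - 1) * lookup y 1 else 0)"
proof -
  have "lookup (bracket n x y) k = (\<Sum>i\<in>{2..<n}. if i = k - 1 \<and> k \<noteq> 0 then
      lookup x 1 * lookup y i + lookup x i * lookup y 1 else 0)"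
    unfolding bracket_def lookup_sum by (intro sum.cong) (auto simp: lookup_single when_def)
  also have "\<dots> = (if 3 \<le> k \<and> k \<le> n
      then lookup x 1 * lookup y (k - 1) + lookup x (k - 1) * lookup y 1 else 0)"
    by (cases "k = 0") auto
  finally show ?thesis .
qed

lemma bracket_bv:
  "bracket n (bv 1) (bv i) = (if 2 \<le> i \<and> i < n then bv (i + 1) else 0)"
  "i \<noteq> 1 \<Longrightarrow> j \<noteq> 1 \<Longrightarrow> bracket n (bv i) (bv j) = 0"
  by (auto intro!: poly_mapping_eqI simp: lookup_bracket lookup_single when_def)

lemma bracket_in_m0: "bracket n x y \<in> m0 n"
  by (auto simp: m0_def in_keys_iff lookup_bracket split: if_splits)

lemma bracket_add:
  "bracket n (x + x') y = bracket n x y + bracket n x' y"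
  "bracket n x (y + y') = bracket n x y + bracket n x y'"
  by (auto intro!: poly_mapping_eqI simp: lookup_bracket lookup_add algebra_simps)

lemma bracket_self: "bracket n x x = 0"
proof -
  have "a * b + b * a = 0" for a b :: bit
    by (cases a) simp_all
  then show ?thesis
    by (intro poly_mapping_eqI) (simp only: lookup_bracket lookup_zero if_cancel)
qed

lemma bracket_jacobi:
  "bracket n x (bracket n y z) + bracket n y (bracket n z x) + bracket n z (bracket n x y) = 0"
proof (rule poly_mapping_eqI)
  fix k
  have *: "a * (b * c' + b' * c) + b * (c * a' + c' * a) + c * (a * b' + a' * b) = 0" for a b c a' b' c' :: bit
    by (cases a; cases b; cases c; cases a'; cases b'; cases c'; simp)
  show "lookup (bracket n x (bracket n y z) + bracket n y (bracket n z x) + bracket n z (bracket n x y)) k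
      = lookup 0 k"
    by (auto simp: lookup_add lookup_bracket *)
qed

text \<open>
  In \<open>diff\<close> and \<open>Dop\<close> the values on generators outside the intended index range (\<open>e 0\<close>, and
  \<open>e 1\<close> for \<open>Dop\<close>) are never used.
\<close>

definition diff :: "form \<Rightarrow> form" where
  "diff = derivation (\<lambda>i. if 3 \<le> i then e 1 \<and>\<^sub>e e (i - 1) else 0)"

definition Dop :: "form \<Rightarrow> form" where
  "Dop = derivation (\<lambda>i. if 2 < i then e (i - 1) else 0)"

text \<open>On generators, \<open>diff\<close> is the dual of the bracket.\<close>

lemma diff_e_bracket:
  assumes "1 \<le> k" "k \<le> n"
  shows "diff (e k) = (\<Sum>(i, j) | 1 \<le> i \<and> i < j \<and> j \<le> n.
    scal (lookup (bracket n (bv i) (bv j)) k) (e i \<and>\<^sub>e e j))"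
proof -
  let ?P = "{(i, j). 1 \<le> i \<and> i < j \<and> j \<le> n}"
  have fin: "finite ?P"
    by (rule finite_subset[of _ "{1..n} \<times> {1..n}"]) auto
  have "(\<Sum>(i, j)\<in>?P. scal (lookup (bracket n (bv i) (bv j)) k) (e i \<and>\<^sub>e e j))
      = (\<Sum>p\<in>?P. if p = (1, k - 1) then if 3 \<le> k then e 1 \<and>\<^sub>e e (k - 1) else 0 else 0)"
  proof (rule sum.cong[OF refl], clarify)
    fix i j assume "1 \<le> i" "i < j" "j \<le> n"
    then have "lookup (bracket n (bv i) (bv j)) k = (if i = 1 \<and> j = k - 1 \<and> 3 \<le> k then 1 else 0)"
      using assms by (cases "i = 1"; cases "j = k - 1") (auto simp: lookup_bracket lookup_single when_def)
    then show "scal (lookup (bracket n (bv i) (bv j)) k) (e i \<and>\<^sub>e e j)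
        = (if (i, j) = (1, k - 1) then if 3 \<le> k then e 1 \<and>\<^sub>e e (k - 1) else 0 else 0)"
      by auto
  qed
  also have "\<dots> = (if 3 \<le> k then e 1 \<and>\<^sub>e e (k - 1) else 0)"
    using assms by (subst sum.delta[OF fin]) auto
  finally show ?thesis by (simp add: diff_def)
qed

definition F :: "form \<Rightarrow> nat \<Rightarrow> form" where
  "F \<omega> i = Sum_any (\<lambda>l. (Dop ^^ l) \<omega> \<and>\<^sub>e e (i + 1 + l))"

lemma F_e_e:
  assumes "2 \<le> i"
  shows "F (e i) i = (\<Sum>l = 0..i - 2. e (i - l) \<and>\<^sub>e e (i + 1 + l))"
proof -
  have D: "(Dop ^^ l) (e i) = (if l \<le> i - 2 then e (i - l) else 0)" for l
    using assms by (induction l) (auto simp: Dop_def)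
  have "F (e i) i = (\<Sum>l = 0..i - 2. (Dop ^^ l) (e i) \<and>\<^sub>e e (i + 1 + l))"
    unfolding F_def by (rule Sum_any.expand_superset) (auto simp: D)
  then show ?thesis by (simp add: D)
qed

text \<open>\<open>Lam n q\<close> is the degree \<open>q\<close> component of the exterior algebra on \<open>e 1, \<dots>, e n\<close>.\<close>

definition Lam :: "nat \<Rightarrow> nat \<Rightarrow> form set" where
  "Lam n q = {\<omega>. \<forall>I\<in>keys \<omega>. I \<subseteq> {1..n} \<and> card I = q}"

definition cocycles :: "nat \<Rightarrow> nat \<Rightarrow> form set" where
  "cocycles n q = {\<omega> \<in> Lam n q. diff \<omega> = 0}"

fun coboundaries :: "nat \<Rightarrow> nat \<Rightarrow> form set" where
  "coboundaries n 0 = {0}"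
| "coboundaries n (Suc q) = diff ` Lam n q"

definition form_space :: "form set \<Rightarrow> (bit, form) module" where
  "form_space W = \<lparr> carrier = W, mult = wedge, one = emon {}, zero = 0, add = (+), smult = scal \<rparr>"

definition H :: "nat \<Rightarrow> nat \<Rightarrow> (bit, form set) module" where
  "H n q = quot_module (form_space (cocycles n q)) (coboundaries n q)"

definition cls :: "nat \<Rightarrow> nat \<Rightarrow> form \<Rightarrow> form set" where
  "cls n q \<omega> = coboundaries n q +>\<^bsub>form_space (cocycles n q)\<^esub> \<omega>"

definition betti :: "nat \<Rightarrow> nat \<Rightarrow> nat" where
  "betti n q = vectorspace.dim Z2 (H n q)"

lemma zero_in_Lam: "0 \<in> Lam n q"
  by (simp add: Lam_def)

lemma add_in_Lam: "\<alpha> \<in> Lam n q \<Longrightarrow> \<beta> \<in> Lam n q \<Longrightarrow> \<alpha> + \<beta> \<in> Lam n q"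
  using Poly_Mapping.keys_add[of \<alpha> \<beta>] by (auto simp: Lam_def)

lemma sum_in_Lam: "(\<And>a. a \<in> A \<Longrightarrow> f a \<in> Lam n q) \<Longrightarrow> sum f A \<in> Lam n q"
  by (induction A rule: infinite_finite_induct) (auto simp: zero_in_Lam add_in_Lam)

lemma mono_in_Lam: "I \<subseteq> {1..n} \<Longrightarrow> card I = q \<Longrightarrow> emon I \<in> Lam n q"
  by (simp add: Lam_def)

lemma wedge_in_Lam:
  assumes "\<alpha> \<in> Lam n p" "\<beta> \<in> Lam n q"
  shows "\<alpha> \<and>\<^sub>e \<beta> \<in> Lam n (p + q)"
proof -
  have "emon I \<and>\<^sub>e emon J \<in> Lam n (p + q)" if "I \<in> keys \<alpha>" "J \<in> keys \<beta>" for I J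
  proof -
    have "I \<subseteq> {1..n}" "card I = p" "J \<subseteq> {1..n}" "card J = q"
      using that assms by (auto simp: Lam_def)
    moreover from this have "finite I" "finite J"
      by (auto intro: finite_subset)
    ultimately show ?thesis
      by (auto simp: zero_in_Lam card_Un_disjoint intro!: mono_in_Lam)
  qed
  then show ?thesis
    by (subst form_eq_sum[of \<alpha>], subst form_eq_sum[of \<beta>])
      (auto simp only: wedge_sum_left wedge_sum_right intro!: sum_in_Lam)
qed

lemma diff_in_Lam:
  assumes "\<omega> \<in> Lam n q"
  shows "diff \<omega> \<in> Lam n (Suc q)"
proof -
  have "(if 3 \<le> i then e 1 \<and>\<^sub>e e (i - 1) else 0) \<and>\<^sub>e emon (I - {i}) \<in> Lam n (Suc q)"
    if "I \<in> keys \<omega>" "i \<in> I" for I i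
  proof (cases "3 \<le> i")
    case True
    have I: "I \<subseteq> {1..n}" "card I = q" using that assms by (auto simp: Lam_def)
    then have "finite I" by (auto intro: finite_subset)
    then have q: "card (I - {i}) = q - 1" "q > 0"
      using I that by (auto simp: card_gt_0_iff)
    have "1 \<le> i" "i \<le> n" using I that by auto
    then have "e 1 \<in> Lam n 1" "e (i - 1) \<in> Lam n 1"
      using True unfolding e_def by (auto intro!: mono_in_Lam)
    then have "e 1 \<and>\<^sub>e e (i - 1) \<and>\<^sub>e emon (I - {i}) \<in> Lam n (1 + 1 + (q - 1))"
      using I q by (intro wedge_in_Lam mono_in_Lam) auto
    then show ?thesis using q True by simp
  qed (simp add: zero_in_Lam)
  then show ?thesis
    by (subst form_eq_sum[of \<omega>])
      (auto simp only: diff_def derivation_sum derivation_mono intro!: sum_in_Lam)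
qed

lemma diff_eq: "diff \<omega> = e 1 \<and>\<^sub>e Dop \<omega>"
proof -
  have "diff (emon I) = e 1 \<and>\<^sub>e Dop (emon I)" for I
    by (auto simp: diff_def Dop_def derivation_mono wedge_sum_right wedge_assoc intro!: sum.cong)
  then show ?thesis
    by (subst (1 2) form_eq_sum[of \<omega>])
      (simp only: diff_def Dop_def derivation_sum wedge_sum_right)
qed

lemma diff_diff:
  assumes "\<omega> \<in> Lam n q"
  shows "diff (diff \<omega>) = 0"
proof -
  have fin: "finite I" if "I \<in> keys (Dop \<omega>)" for I
  proof -
    have "Dop \<omega> \<in> {\<omega>. \<forall>I\<in>keys \<omega>. finite I}" (is "_ \<in> ?S")
    proof -
      have add: "\<alpha> + \<beta> \<in> ?S" if "\<alpha> \<in> ?S" "\<beta> \<in> ?S" for \<alpha> \<beta> :: form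
        using that Poly_Mapping.keys_add[of \<alpha> \<beta>] by auto
      have sum: "sum f A \<in> ?S" if "\<And>a. a \<in> A \<Longrightarrow> f a \<in> ?S" for f :: "'z \<Rightarrow> form" and A
        using that
      proof (induction A rule: infinite_finite_induct)
        case (insert x A)
        have "f x + sum f A \<in> ?S"
            using insert by (intro add) blast+
          with insert.hyps show ?case by (subst sum.insert)
      qed auto
      have "(if 2 < i then e (i - 1) else 0) \<and>\<^sub>e emon (I - {i}) \<in> ?S"
        if "I \<in> keys \<omega>" for i I
      proof -
        have "finite I" using that assms by (auto simp: Lam_def intro: finite_subset)
        then show ?thesis by (simp add: e_def)
      qed
      then show ?thesis
        by (subst form_eq_sum[of \<omega>])
          (auto simp only: Dop_def derivation_sum derivation_mono intro!: sum)
    qed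
    then show ?thesis using that by simp
  qed
  have "Dop (e 1 \<and>\<^sub>e Dop \<omega>) = e 1 \<and>\<^sub>e Dop (Dop \<omega>)"
    unfolding Dop_def
    by (subst derivation_wedge) (use fin in \<open>auto simp: Dop_def e_def derivation_mono\<close>)
  then show ?thesis
    by (simp add: diff_eq flip: wedge_assoc)
qed

text \<open>The cohomology spaces are vector spaces over \<open>\<int>\<^sub>2\<close>.\<close>

lemma H_vectorspace: "vectorspace Z2 (H n q)"
proof -
  have scal_cases: "scal c \<omega> = 0 \<or> scal c \<omega> = \<omega>" for c \<omega>
    by (cases c) auto
  have d0: "diff 0 = 0" and dadd: "diff (\<alpha> + \<beta>) = diff \<alpha> + diff \<beta>" for \<alpha> \<beta>
    by (simp_all add: diff_def derivation_add)
  have Z: "0 \<in> cocycles n q"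
    "\<And>\<alpha> \<beta>. \<alpha> \<in> cocycles n q \<Longrightarrow> \<beta> \<in> cocycles n q \<Longrightarrow> \<alpha> + \<beta> \<in> cocycles n q"
    by (auto simp: cocycles_def zero_in_Lam add_in_Lam d0 dadd)
  have B: "0 \<in> coboundaries n q" "coboundaries n q \<subseteq> cocycles n q"
    "\<And>\<alpha> \<beta>. \<alpha> \<in> coboundaries n q \<Longrightarrow> \<beta> \<in> coboundaries n q \<Longrightarrow> \<alpha> + \<beta> \<in> coboundaries n q"
    using Z(1) zero_in_Lam d0
    by (cases q; force simp: cocycles_def diff_in_Lam diff_diff simp flip: dadd intro: add_in_Lam)+
  have "Module.module Z2 (form_space (cocycles n q))"
  proof (rule moduleI)
    show "cring Z2" by (rule class_cring.is_cring)
    show "abelian_group (form_space (cocycles n q))"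
    proof (rule abelian_groupI)
      fix x assume "x \<in> carrier (form_space (cocycles n q))"
      then show "\<exists>y\<in>carrier (form_space (cocycles n q)).
          y \<oplus>\<^bsub>form_space (cocycles n q)\<^esub> x = \<zero>\<^bsub>form_space (cocycles n q)\<^esub>"
        by (intro bexI[of _ x]) (auto simp: form_space_def)
    qed (auto simp: form_space_def Z add_ac)
  next
    fix a x assume "x \<in> carrier (form_space (cocycles n q))"
    then show "a \<odot>\<^bsub>form_space (cocycles n q)\<^esub> x \<in> carrier (form_space (cocycles n q))"
      using scal_cases[of a x] Z(1) by (auto simp: form_space_def)
  qed (auto simp: form_space_def scal_add scal_add_left scal_scal)
  then have "Module.module Z2 (H n q)"
    unfolding H_def
  proof (rule quot_module_module)
    fix a x assume "x \<in> coboundaries n q"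
    then show "a \<odot>\<^bsub>form_space (cocycles n q)\<^esub> x \<in> coboundaries n q"
      using scal_cases[of a x] B(1) by (auto simp: form_space_def)
  qed (use B in \<open>auto simp: form_space_def\<close>)
  then show ?thesis
    by (intro vectorspace.intro class_field.field_axioms)
qed

end

theory Submission
  imports Defs
begin

text \<open>
  A 2-form without \<open>e 1\<close> is a cocycle iff its coefficients \<open>a\<^sub>k\<^sub>l\<close> satisfy
  \<open>a\<^bsub>k+1,l\<^esub> = a\<^bsub>k,l+1\<^esub>\<close>, that is, iff they are constant along every antidiagonal
  \<open>k + l = s\<close>.  If \<open>s\<close> is even, the antidiagonal meets the diagonal, and if \<open>s > n + 2\<close> it leaves
  the index range; in both cases the constant is \<open>0\<close>.  The indicator of the antidiagonal
  \<open>s = 2 * m + 1 \<le> n + 2\<close> is \<open>F (e m) m\<close>.  Among the monomials \<open>e 1 \<and>\<^sub>e e j\<close>, all cocycles,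
  exactly those with \<open>2 \<le> j < n\<close> are coboundaries, which leaves \<open>e 1 \<and>\<^sub>e e n\<close>.
\<close>

section \<open>Closure properties of cocycles and coboundaries\<close>

lemma diff_0 [simp]: "diff 0 = 0"
  by (simp add: diff_def)

lemma diff_add: "diff (\<alpha> + \<beta>) = diff \<alpha> + diff \<beta>"
  by (simp add: diff_def derivation_add)

lemma diff_sum: "diff (sum f A) = (\<Sum>a\<in>A. diff (f a))"
  by (simp add: diff_def derivation_sum)

lemma zero_in_cocycles: "0 \<in> cocycles n q"
  by (simp add: cocycles_def zero_in_Lam)

lemma add_in_cocycles: "\<alpha> \<in> cocycles n q \<Longrightarrow> \<beta> \<in> cocycles n q \<Longrightarrow> \<alpha> + \<beta> \<in> cocycles n q"
  by (simp add: cocycles_def add_in_Lam diff_add)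

lemma scal_in_cocycles: "\<omega> \<in> cocycles n q \<Longrightarrow> scal c \<omega> \<in> cocycles n q"
  by (cases c) (simp_all add: zero_in_cocycles)

lemma sum_in_cocycles: "(\<And>a. a \<in> A \<Longrightarrow> f a \<in> cocycles n q) \<Longrightarrow> sum f A \<in> cocycles n q"
  by (induction A rule: infinite_finite_induct) (auto simp: zero_in_cocycles add_in_cocycles)

lemma zero_in_coboundaries: "0 \<in> coboundaries n q"
  by (cases q) (auto intro!: image_eqI[of _ _ 0] simp: zero_in_Lam)

lemma add_in_coboundaries:
  "\<alpha> \<in> coboundaries n q \<Longrightarrow> \<beta> \<in> coboundaries n q \<Longrightarrow> \<alpha> + \<beta> \<in> coboundaries n q"
  by (cases q) (auto simp: add_in_Lam simp flip: diff_add)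

lemma sum_in_coboundaries:
  "(\<And>a. a \<in> A \<Longrightarrow> f a \<in> coboundaries n q) \<Longrightarrow> sum f A \<in> coboundaries n q"
  by (induction A rule: infinite_finite_induct)
    (simp_all add: zero_in_coboundaries add_in_coboundaries)

lemma add_cancel_form [simp]: "\<alpha> + (\<alpha> + \<beta>) = (\<beta> :: form)"
  by (simp flip: add.assoc)

section \<open>Cohomology classes and the operations on them\<close>

lemma cls_eq_image: "cls n q \<omega> = (\<lambda>b. b + \<omega>) ` coboundaries n q"
  by (auto simp: cls_def a_r_coset_def r_coset_def form_space_def)

text \<open>In characteristic 2 the difference of two forms is their sum, so a coset condition needs
  no subtraction.\<close>

lemma mem_cls_iff: "\<alpha> \<in> cls n q \<omega> \<longleftrightarrow> \<alpha> + \<omega> \<in> coboundaries n q"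
proof
  assume "\<alpha> + \<omega> \<in> coboundaries n q"
  then show "\<alpha> \<in> cls n q \<omega>"
    unfolding cls_eq_image by (rule rev_image_eqI) (simp add: add.assoc)
qed (auto simp: cls_eq_image add.assoc)

lemma cls_eq_iff: "cls n q \<alpha> = cls n q \<beta> \<longleftrightarrow> \<alpha> + \<beta> \<in> coboundaries n q"
proof
  assume "cls n q \<alpha> = cls n q \<beta>"
  moreover have "\<alpha> \<in> cls n q \<alpha>" by (simp add: mem_cls_iff zero_in_coboundaries)
  ultimately show "\<alpha> + \<beta> \<in> coboundaries n q" by (simp add: mem_cls_iff)
next
  assume *: "\<alpha> + \<beta> \<in> coboundaries n q"
  have "\<gamma> + \<alpha> + (\<alpha> + \<beta>) = \<gamma> + \<beta>" "\<gamma> + \<beta> + (\<alpha> + \<beta>) = \<gamma> + \<alpha>" for \<gamma>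
    by (simp_all add: add_ac)
  then show "cls n q \<alpha> = cls n q \<beta>"
    using add_in_coboundaries[OF _ *] by (metis mem_cls_iff subsetI equalityI)
qed

lemma carrier_H: "carrier (H n q) = cls n q ` cocycles n q"
  by (auto simp: H_def quot_module_def A_RCOSETS_defs cls_def a_r_coset_def r_coset_def
      form_space_def)

lemma zero_H: "\<zero>\<^bsub>H n q\<^esub> = cls n q 0"
  by (simp add: H_def quot_module_def cls_eq_image)

lemma add_H: "cls n q \<alpha> \<oplus>\<^bsub>H n q\<^esub> cls n q \<beta> = cls n q (\<alpha> + \<beta>)"
proof -
  have "cls n q \<alpha> \<oplus>\<^bsub>H n q\<^esub> cls n q \<beta> = {x + y | x y. x \<in> cls n q \<alpha> \<and> y \<in> cls n q \<beta>}"
    by (auto simp: H_def quot_module_def set_add_defs form_space_def)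
  also have "\<dots> = cls n q (\<alpha> + \<beta>)"
  proof (intro equalityI subsetI)
    fix z assume "z \<in> cls n q (\<alpha> + \<beta>)"
    then obtain b where "b \<in> coboundaries n q" "z = (b + \<alpha>) + (0 + \<beta>)"
      by (auto simp: cls_eq_image add_ac)
    then show "z \<in> {x + y | x y. x \<in> cls n q \<alpha> \<and> y \<in> cls n q \<beta>}"
      using zero_in_coboundaries unfolding cls_eq_image by blast
  next
    fix z assume "z \<in> {x + y | x y. x \<in> cls n q \<alpha> \<and> y \<in> cls n q \<beta>}"
    then obtain b c where "b \<in> coboundaries n q" "c \<in> coboundaries n q" "z = (b + c) + (\<alpha> + \<beta>)"
      by (auto simp: cls_eq_image add_ac)
    then show "z \<in> cls n q (\<alpha> + \<beta>)"
      using add_in_coboundaries unfolding cls_eq_image by blast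
  qed
  finally show ?thesis .
qed

text \<open>Scalar multiplication in the quotient is a union over all representatives of the class.
  The scalar is 0 or 1, and in both cases every representative contributes the same class.\<close>

lemma smult_H: "c \<odot>\<^bsub>H n q\<^esub> cls n q \<alpha> = cls n q (scal c \<alpha>)"
proof -
  have "c \<odot>\<^bsub>H n q\<^esub> cls n q \<alpha> = (\<Union>x\<in>cls n q \<alpha>. cls n q (scal c x))"
    by (simp add: H_def quot_module_def cls_def form_space_def)
  moreover have "cls n q (scal c x) = cls n q (scal c \<alpha>)" if "x \<in> cls n q \<alpha>" for x
    using that unfolding cls_eq_iff mem_cls_iff
    by (cases c) (simp_all add: zero_in_coboundaries)
  moreover have "\<alpha> \<in> cls n q \<alpha>" by (simp add: mem_cls_iff zero_in_coboundaries)
  ultimately show ?thesis by blast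
qed

section \<open>Linear combinations and bases in cohomology\<close>

text \<open>\<open>lincomb\<close> sums over a set of vectors, where equal classes would be counted
  only once. Injectivity makes this the sum over the index set \<open>A\<close>.\<close>

lemma lincomb_cls:
  assumes "finite A" "f ` A \<subseteq> cocycles n q" "inj_on (\<lambda>i. cls n q (f i)) A"
  shows "LinearCombinations.module.lincomb (H n q) a ((\<lambda>i. cls n q (f i)) ` A)
    = cls n q (\<Sum>i\<in>A. scal (a (cls n q (f i))) (f i))"
proof -
  interpret vectorspace Z2 "H n q" by (rule H_vectorspace)
  show ?thesis
    using assms
  proof (induction A rule: finite_induct)
    case empty
    then show ?case by (simp add: lincomb_def zero_H)
  next
    case (insert i A)
    have car: "cls n q (f j) \<in> carrier (H n q)" if "j \<in> insert i A" for j
      using insert.prems that by (auto simp: carrier_H)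
    have "cls n q (f i) \<notin> (\<lambda>i. cls n q (f i)) ` A"
      using insert.prems insert.hyps by (auto simp: inj_on_def)
    then have "lincomb a ((\<lambda>i. cls n q (f i)) ` insert i A)
        = a (cls n q (f i)) \<odot>\<^bsub>H n q\<^esub> cls n q (f i) \<oplus>\<^bsub>H n q\<^esub> lincomb a ((\<lambda>i. cls n q (f i)) ` A)"
      using lincomb_insert[of "(\<lambda>i. cls n q (f i)) ` A" a "cls n q (f i)"] car insert.hyps
      by (auto simp: class_ring_simps)
    also have "lincomb a ((\<lambda>i. cls n q (f i)) ` A) = cls n q (\<Sum>i\<in>A. scal (a (cls n q (f i))) (f i))"
      using insert.prems by (intro insert.IH) auto
    finally show ?case
      using insert.hyps by (simp add: smult_H add_H)
  qed
qed

text \<open>Reduces generation and dimension in the quotient to two statements about forms: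
  \<open>f\<close> generates the cocycles modulo coboundaries and is independent modulo
  coboundaries. Independence also makes the classes distinct, so that they can be counted by
  \<open>A\<close>.\<close>

lemma H_basisI:
  assumes finA: "finite A" and Z: "f ` A \<subseteq> cocycles n q"
    and gen: "\<And>\<omega>. \<omega> \<in> cocycles n q \<Longrightarrow> \<exists>c. \<omega> + (\<Sum>i\<in>A. scal (c i) (f i)) \<in> coboundaries n q"
    and indep: "\<And>c. (\<Sum>i\<in>A. scal (c i) (f i)) \<in> coboundaries n q \<Longrightarrow> \<forall>i\<in>A. c i = 0"
  shows "LinearCombinations.module.span Z2 (H n q) (cls n q ` f ` A) = carrier (H n q)"
    and "betti n q = card A"
proof -
  interpret vectorspace Z2 "H n q" by (rule H_vectorspace)
  let ?g = "\<lambda>i. cls n q (f i)"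
  have inj: "inj_on ?g A"
  proof (rule inj_onI, rule ccontr)
    fix i j assume ij: "i \<in> A" "j \<in> A" "?g i = ?g j" "i \<noteq> j"
    \<comment> \<open>Equal classes would make \<open>f i + f j\<close> a coboundary. Written as a
      combination over all of \<open>A\<close>, it has coefficient 1 at \<open>i\<close>, against
      \<open>indep\<close>.\<close>
    have "(\<Sum>k\<in>A. scal (if k \<in> {i, j} then 1 else 0) (f k)) = (\<Sum>k\<in>{i, j}. f k)"
      using ij finA by (intro sum.mono_neutral_cong_right) auto
    also have "\<dots> \<in> coboundaries n q"
      using ij by (simp add: cls_eq_iff)
    finally have "\<forall>k\<in>A. (if k \<in> {i, j} then 1 else 0) = (0 :: bit)"
      by (rule indep)
    then show False
      using ij(1) by (auto dest: bspec[of _ _ i])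
  qed
  have lc: "lincomb a (?g ` A) = cls n q (\<Sum>i\<in>A. scal (a (?g i)) (f i))" for a
    using finA Z inj by (rule lincomb_cls)
  have car: "?g ` A \<subseteq> carrier (H n q)"
    using Z by (auto simp: carrier_H)
  have fing: "finite (?g ` A)" using finA by simp
  have span: "span (?g ` A) = carrier (H n q)"
  proof (intro equalityI subsetI)
    fix X assume "X \<in> span (?g ` A)"
    then obtain a where "X = lincomb a (?g ` A)"
      using finite_span[OF fing car] by blast
    moreover have "(\<Sum>i\<in>A. scal (a (?g i)) (f i)) \<in> cocycles n q"
      using Z by (intro sum_in_cocycles scal_in_cocycles) auto
    ultimately show "X \<in> carrier (H n q)"
      by (simp add: lc carrier_H)
  next
    fix X assume "X \<in> carrier (H n q)"
    then obtain \<omega> where \<omega>: "\<omega> \<in> cocycles n q" "X = cls n q \<omega>"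
      by (auto simp: carrier_H)
    obtain c where c: "\<omega> + (\<Sum>i\<in>A. scal (c i) (f i)) \<in> coboundaries n q"
      using gen[OF \<omega>(1)] by blast
    \<comment> \<open>The coefficients of \<open>lincomb\<close> are indexed by classes, so
      \<open>c\<close> is transported along the inverse of the injective map
      \<open>?g\<close>.\<close>
    have "lincomb (\<lambda>v. c (the_inv_into A ?g v)) (?g ` A) = cls n q (\<Sum>i\<in>A. scal (c i) (f i))"
      unfolding lc using inj by (intro arg_cong[where f = "cls n q"] sum.cong)
        (simp_all add: the_inv_into_f_f[OF inj])
    also have "\<dots> = X"
      using c \<omega> by (simp add: cls_eq_iff add.commute)
    finally show "X \<in> span (?g ` A)"
      unfolding finite_span[OF fing car] by (auto simp: class_ring_simps)
  qed
  then show "span (cls n q ` f ` A) = carrier (H n q)"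
    by (simp add: image_image)
  have "lin_indpt (?g ` A)"
  proof (rule finite_lin_indpt2[OF fing car])
    fix a assume "lincomb a (?g ` A) = \<zero>\<^bsub>H n q\<^esub>"
    then have "(\<Sum>i\<in>A. scal (a (?g i)) (f i)) \<in> coboundaries n q"
      by (simp add: lc zero_H cls_eq_iff)
    then show "\<forall>v\<in>?g ` A. a v = \<zero>\<^bsub>Z2\<^esub>"
      using indep[of "\<lambda>i. a (?g i)"] by (auto simp: class_ring_simps)
  qed
  then have "basis (?g ` A)"
    using span car unfolding basis_def by blast
  then show "betti n q = card A"
    unfolding betti_def using dim_basis[OF fing] card_image[OF inj] by simp
qed

section \<open>Coefficients of differentials in degrees 1 and 2\<close>

lemma lookup_emon: "lookup (emon I) J = (if I = J then 1 else 0)"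
  by (simp add: lookup_single when_def)

lemma e_wedge_e: "e i \<and>\<^sub>e e j = (if i = j then 0 else emon {i, j})"
  by (simp add: e_def insert_commute)

lemma diff_e: "diff (e i) = (if 3 \<le> i then e 1 \<and>\<^sub>e e (i - 1) else 0)"
  by (simp add: diff_def)

lemma diff_e_wedge_e: "diff (e i \<and>\<^sub>e e j) = diff (e i) \<and>\<^sub>e e j + e i \<and>\<^sub>e diff (e j)"
  unfolding diff_def by (rule derivation_wedge) (auto simp: e_def)

lemma lookup_eq_0_Lam:
  assumes "\<omega> \<in> Lam n q" "\<not> (I \<subseteq> {1..n} \<and> card I = q)"
  shows "lookup \<omega> I = 0"
proof (rule ccontr)
  assume "lookup \<omega> I \<noteq> 0"
  then have "I \<in> keys \<omega>" by (simp add: in_keys_iff)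
  then show False using assms unfolding Lam_def by blast
qed

text \<open>Every key of a form has coefficient 1, so linearity leaves a plain sum over
  monomials.\<close>

lemma lookup_diff: "lookup (diff \<omega>) K = (\<Sum>I\<in>keys \<omega>. lookup (diff (emon I)) K)"
  by (subst form_eq_sum) (simp only: diff_sum lookup_sum)

text \<open>Among the generators, only \<open>e (k + 1)\<close> has
  \<open>e 1 \<and>\<^sub>e e k\<close> as its differential.\<close>

lemma lookup_diff_Lam_1:
  assumes "\<omega> \<in> Lam n 1" "2 \<le> k"
  shows "lookup (diff \<omega>) {1, k} = lookup \<omega> {k + 1}"
proof -
  have "lookup (diff (emon I)) {1, k} = (if I = {k + 1} then 1 else 0)" if "I \<in> keys \<omega>" for I
  proof -
    have "card I = 1" using assms(1) that by (auto simp: Lam_def)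
    then obtain i where "I = {i}" by (auto simp: card_1_singleton_iff)
    then show ?thesis
      using assms(2) diff_e[of i] by (auto simp: e_wedge_e lookup_emon e_def doubleton_eq_iff)
  qed
  then have "lookup (diff \<omega>) {1, k} = (\<Sum>I\<in>keys \<omega>. if I = {k + 1} then 1 else 0)"
    unfolding lookup_diff[of \<omega>] by (intro sum.cong refl)
  then show ?thesis
    by (simp add: in_keys_iff)
qed

text \<open>Multiplication by \<open>e 1\<close> kills every product that contains
  \<open>e 1\<close> and adds the index 1 to the key of any other monomial, so the remaining two
  indices can be read off.\<close>

lemma lookup_e_1_wedge:
  assumes "2 \<le> k" "k < l"
  shows "lookup (e 1 \<and>\<^sub>e (e a \<and>\<^sub>e e b)) {1, k, l} = (if {a, b} = {k, l} then 1 else 0)"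
proof (cases "a = b \<or> 1 \<in> {a, b}")
  case True
  moreover have "e 1 \<and>\<^sub>e (e 1 \<and>\<^sub>e \<omega>) = 0" for \<omega>
    by (simp flip: wedge_assoc)
  moreover have "e 1 \<and>\<^sub>e (e a \<and>\<^sub>e e 1) = 0"
    by (simp add: wedge_commute[of "e a"] flip: wedge_assoc)
  ultimately have "e 1 \<and>\<^sub>e (e a \<and>\<^sub>e e b) = 0"
    by fastforce
  then show ?thesis
    using True assms by (auto simp: doubleton_eq_iff)
next
  case False
  then have "e 1 \<and>\<^sub>e (e a \<and>\<^sub>e e b) = emon {1, a, b}"
    by (auto simp: e_wedge_e) (simp add: e_def insert_commute)
  moreover have "{1, a, b} = {1, k, l} \<longleftrightarrow> {a, b} = {k, l}"
    using False assms by (intro insert_ident) auto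
  ultimately show ?thesis
    by (simp add: lookup_emon)
qed

text \<open>The differential multiplies by \<open>e 1\<close> and lowers one of the two indices, so
  the key \<open>{1, k, l}\<close> is reached from \<open>{k + 1, l}\<close> and
  \<open>{k, l + 1}\<close> only. If \<open>l = k + 1\<close>, the first of these is a singleton, at
  which a form of degree 2 has coefficient 0.\<close>

lemma lookup_diff_Lam_2:
  assumes "\<omega> \<in> Lam n 2" "2 \<le> k" "k < l"
  shows "lookup (diff \<omega>) {1, k, l} = lookup \<omega> {k + 1, l} + lookup \<omega> {k, l + 1}"
proof -
  have "lookup (diff (emon I)) {1, k, l}
      = (if I = {k + 1, l} then 1 else 0) + (if I = {k, l + 1} then 1 else 0)" if "I \<in> keys \<omega>" for I
  proof -
    have "card I = 2" using assms(1) that by (auto simp: Lam_def)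
    then obtain i j where ij: "I = {i, j}" "i \<noteq> j"
      by (auto simp: card_2_iff)
    have "diff (emon I) = (if 3 \<le> i then e 1 \<and>\<^sub>e (e (i - 1) \<and>\<^sub>e e j) else 0)
        + (if 3 \<le> j then e 1 \<and>\<^sub>e (e i \<and>\<^sub>e e (j - 1)) else 0)"
      using ij diff_e_wedge_e[of i j]
      by (simp add: e_wedge_e[of i j] diff_e wedge_assoc wedge_left_commute[of "e i"])
    then have "lookup (diff (emon I)) {1, k, l} = (if 3 \<le> i \<and> {i - 1, j} = {k, l} then 1 else 0)
        + (if 3 \<le> j \<and> {i, j - 1} = {k, l} then 1 else 0)"
      by (simp add: lookup_add lookup_e_1_wedge[OF assms(2,3), unfolded One_nat_def])
    \<comment> \<open>The four ways of lowering an index are regrouped by the key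
      \<open>{i, j}\<close> they start from. The alternatives merged into one indicator exclude each
      other because \<open>i \<noteq> j\<close> and \<open>k < l\<close>.\<close>
    also have "\<dots> = (if i = k + 1 \<and> j = l \<or> i = l \<and> j = k + 1 then 1 else 0)
        + (if i = k \<and> j = l + 1 \<or> i = l + 1 \<and> j = k then 1 else 0)"
    proof -
      have "3 \<le> i \<and> {i - 1, j} = {k, l} \<longleftrightarrow> i = k + 1 \<and> j = l \<or> i = l + 1 \<and> j = k"
        "3 \<le> j \<and> {i, j - 1} = {k, l} \<longleftrightarrow> i = k \<and> j = l + 1 \<or> i = l \<and> j = k + 1"
        using ij assms(2,3) by (auto simp: doubleton_eq_iff)
      then show ?thesis
        using ij(2) assms(3) by auto
    qed
    also have "\<dots> = (if I = {k + 1, l} then 1 else 0) + (if I = {k, l + 1} then 1 else 0)"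
      by (simp only: ij(1) doubleton_eq_iff)
    finally show ?thesis .
  qed
  then have "lookup (diff \<omega>) {1, k, l}
      = (\<Sum>I\<in>keys \<omega>. (if I = {k + 1, l} then 1 else 0) + (if I = {k, l + 1} then 1 else 0))"
    unfolding lookup_diff[of \<omega>] by (intro sum.cong refl)
  moreover have "(\<Sum>I\<in>keys \<omega>. if I = K then 1 else 0) = lookup \<omega> K" for K
    by (auto simp: in_keys_iff)
  ultimately show ?thesis
    by (simp only: sum.distrib)
qed

section \<open>Coboundaries of degrees 1 and 2\<close>

text \<open>In degree 0 the only monomial is \<open>emon {}\<close>, which has no generator to
  differentiate.\<close>

lemma coboundaries_1: "coboundaries n 1 = {0}"
proof -
  have "diff \<omega> = 0" if "\<omega> \<in> Lam n 0" for \<omega>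
  proof -
    have "diff (emon I) = 0" if "I \<in> keys \<omega>" for I
    proof -
      have "I \<subseteq> {1..n}" "card I = 0"
        using that \<open>\<omega> \<in> Lam n 0\<close> unfolding Lam_def by blast+
      \<comment> \<open>Infinite sets also have cardinality 0; the inclusion in
        \<open>{1..n}\<close> excludes them.\<close>
      then have "I = {}"
        by (metis card_0_eq finite_atLeastAtMost finite_subset)
      then show ?thesis
        by (simp add: diff_def derivation_mono)
    qed
    then show ?thesis
      by (subst form_eq_sum[of \<omega>]) (simp add: diff_sum)
  qed
  then have "diff ` Lam n 0 \<subseteq> {0}" by blast
  then show ?thesis
    using zero_in_coboundaries[of n 1] by auto
qed

text \<open>Forms of degree 1 are spanned by the \<open>e i\<close> with \<open>i \<le> n\<close>,
  and a nonzero \<open>diff (e i)\<close> is \<open>e 1 \<and>\<^sub>e e (i - 1)\<close>. As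
  \<open>i\<close> stops at \<open>n\<close>, the index \<open>i - 1\<close> stays below
  \<open>n\<close>.\<close>

lemma lookup_coboundary_2:
  assumes "\<eta> \<in> coboundaries n 2" "lookup \<eta> I \<noteq> 0"
  obtains j where "2 \<le> j" "j < n" "I = {1, j}"
proof -
  have "coboundaries n 2 = diff ` Lam n 1"
    by (simp add: numeral_2_eq_2)
  then obtain \<omega> where \<omega>: "\<omega> \<in> Lam n 1" "\<eta> = diff \<omega>"
    using assms(1) by blast
  have "(\<Sum>K\<in>keys \<omega>. lookup (diff (emon K)) I) \<noteq> 0"
    using assms(2) unfolding \<omega>(2) lookup_diff[of \<omega>] .
  then obtain K where K: "K \<in> keys \<omega>" "lookup (diff (emon K)) I \<noteq> 0"
    by (rule sum.not_neutral_contains_not_neutral)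
  have "K \<subseteq> {1..n}" "card K = 1"
    using \<omega>(1) K(1) unfolding Lam_def by blast+
  then obtain i where i: "K = {i}" "i \<le> n"
    by (auto simp: card_1_singleton_iff)
  have "emon K = e i" by (simp add: i e_def)
  then have "3 \<le> i" "I = {1, i - 1}"
    using K(2) by (auto simp: diff_e e_wedge_e lookup_emon split: if_splits)
  then show ?thesis
    using i(2) by (intro that[of "i - 1"]) auto
qed

text \<open>Converse of \<open>lookup_coboundary_2\<close>: for \<open>2 \<le> j\<close> and
  \<open>j < n\<close> the form \<open>e (j + 1)\<close> is available, and its differential is
  \<open>e 1 \<and>\<^sub>e e j\<close>.\<close>

lemma coboundary_2I:
  assumes "\<And>I. lookup \<eta> I \<noteq> 0 \<Longrightarrow> \<exists>j. 2 \<le> j \<and> j < n \<and> I = {1, j}"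
  shows "\<eta> \<in> coboundaries n 2"
proof -
  have "emon I \<in> coboundaries n 2" if I: "I \<in> keys \<eta>" for I
  proof -
    obtain j where j: "2 \<le> j" "j < n" "I = {1, j}"
      using assms[OF I[unfolded in_keys_iff]] by blast
    have "e (j + 1) \<in> Lam n 1"
      unfolding e_def using j by (intro mono_in_Lam) auto
    moreover have "emon I = diff (e (j + 1))"
      using j by (simp add: diff_e e_wedge_e)
    ultimately show ?thesis
      by (simp add: numeral_2_eq_2)
  qed
  then show ?thesis
    by (subst form_eq_sum[of \<eta>]) (rule sum_in_coboundaries)
qed

section \<open>Cocycles of degrees 1 and 2\<close>

text \<open>The coefficient of \<open>\<omega>\<close> at \<open>{k + 1}\<close> reappears in
  \<open>diff \<omega>\<close> at \<open>{1, k}\<close> when \<open>2 \<le> k\<close>, so only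
  \<open>e 1\<close> and \<open>e 2\<close> can survive.\<close>

lemma cocycle_1_eq:
  assumes "\<omega> \<in> cocycles n 1"
  shows "\<omega> = scal (lookup \<omega> {1}) (e 1) + scal (lookup \<omega> {2}) (e 2)"
proof (rule poly_mapping_eqI)
  fix I
  have \<omega>: "\<omega> \<in> Lam n 1" "diff \<omega> = 0"
    using assms by (auto simp: cocycles_def)
  have zero: "lookup \<omega> {k + 1} = 0" if "2 \<le> k" for k
    using lookup_diff_Lam_1[OF \<omega>(1) that] \<omega>(2) by simp
  show "lookup \<omega> I = lookup (scal (lookup \<omega> {1}) (e 1) + scal (lookup \<omega> {2}) (e 2)) I"
  proof (cases "lookup \<omega> I = 0")
    case True
    then show ?thesis by (auto simp: lookup_add e_def lookup_emon)
  next
    case False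
    then have I: "I \<subseteq> {1..n}" "card I = 1"
      using lookup_eq_0_Lam[OF \<omega>(1)] by blast+
    then obtain i where i: "I = {i}" "1 \<le> i"
      by (auto simp: card_1_singleton_iff)
    have "i \<in> {1, 2}"
      using zero[of "i - 1"] False i by (cases "3 \<le> i") auto
    then show ?thesis
      by (auto simp: i lookup_add e_def lookup_emon)
  qed
qed

text \<open>The cocycle condition at \<open>{1, k, l}\<close> equates neighbours on an antidiagonal,
  and induction moves any entry to the row of index 2. The case \<open>k = l\<close> is included so
  that diagonal entries can be compared as well.\<close>

lemma lookup_cocycle_2_antidiagonal:
  assumes "\<omega> \<in> cocycles n 2" "2 \<le> k" "k \<le> l"
  shows "lookup \<omega> {k, l} = lookup \<omega> {2, k + l - 2}"
  using assms(2,3)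
proof (induction k arbitrary: l rule: dec_induct)
  case base
  then show ?case by simp
next
  case (step k)
  have "lookup \<omega> {k + 1, l} + lookup \<omega> {k, l + 1} = 0"
    using lookup_diff_Lam_2[of \<omega> n k l] assms(1) step by (simp add: cocycles_def)
  then have "lookup \<omega> {k + 1, l} = lookup \<omega> {k, l + 1}"
    by (cases "lookup \<omega> {k + 1, l}"; cases "lookup \<omega> {k, l + 1}") simp_all
  also have "\<dots> = lookup \<omega> {2, k + (l + 1) - 2}"
    using step by (intro step.IH) simp
  finally show ?case by simp
qed

lemma lookup_cocycle_2_eq_0:
  assumes "\<omega> \<in> cocycles n 2" "2 \<le> k" "k \<le> l" "even (k + l) \<or> n + 2 < k + l"
  shows "lookup \<omega> {k, l} = 0"
proof -
  have \<omega>: "\<omega> \<in> Lam n 2" using assms(1) by (simp add: cocycles_def)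
  show ?thesis
  proof (cases "even (k + l)")
    case True
    then obtain m where m: "k + l = 2 * m" by (rule evenE)
    \<comment> \<open>Both entries equal the first one of their common antidiagonal, and
      \<open>{m, m}\<close> is a singleton, hence no key in degree 2.\<close>
    have "lookup \<omega> {k, l} = lookup \<omega> {m, m}"
      using lookup_cocycle_2_antidiagonal[OF assms(1), of k l]
        lookup_cocycle_2_antidiagonal[OF assms(1), of m m] assms m by (simp add: mult_2)
    also have "\<dots> = 0"
      by (rule lookup_eq_0_Lam[OF \<omega>]) simp
    finally show ?thesis .
  next
    case False
    then have "lookup \<omega> {2, k + l - 2} = 0"
      using assms(4) by (intro lookup_eq_0_Lam[OF \<omega>]) auto
    then show ?thesis
      using lookup_cocycle_2_antidiagonal[OF assms(1-3)] by simp
  qed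
qed

section \<open>The cocycles \<open>F (e m) m\<close> and
  \<open>e 1 \<and>\<^sub>e e n\<close>\<close>

text \<open>Different summands have different keys: the smaller index \<open>k\<close> determines
  the summand \<open>t = m - k\<close>, and \<open>t \<le> m - 2\<close> amounts to
  \<open>2 \<le> k\<close>.\<close>

lemma lookup_F_e:
  assumes "2 \<le> m" "k < l"
  shows "lookup (F (e m) m) {k, l} = (if 2 \<le> k \<and> k + l = 2 * m + 1 then 1 else 0)"
proof -
  have "lookup (e (m - t) \<and>\<^sub>e e (m + 1 + t)) {k, l}
      = (if t = m - k then if 2 \<le> k \<and> k + l = 2 * m + 1 then 1 else 0 else 0)"
    if "t \<in> {0..m - 2}" for t
  proof -
    \<comment> \<open>For \<open>k > m\<close> the truncated difference \<open>m - k\<close> is 0,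
      but then \<open>k < l\<close> rules out \<open>k + l = 2 * m + 1\<close>.\<close>
    have "{m - t, m + 1 + t} = {k, l} \<longleftrightarrow> t = m - k \<and> 2 \<le> k \<and> k + l = 2 * m + 1"
      using that assms by (auto simp: doubleton_eq_iff)
    moreover have "m - t \<noteq> m + 1 + t" by simp
    ultimately show ?thesis
      by (simp only: e_wedge_e lookup_emon if_False) simp
  qed
  then have "lookup (F (e m) m) {k, l} = (\<Sum>t = 0..m - 2.
      if t = m - k then if 2 \<le> k \<and> k + l = 2 * m + 1 then 1 else 0 else 0)"
    unfolding F_e_e[OF assms(1)] lookup_sum by (intro sum.cong refl)
  also have "\<dots> = (if 2 \<le> k \<and> k + l = 2 * m + 1 then 1 else 0)"
    by auto
  finally show ?thesis .
qed

lemma sum_add_Suc_form: "(\<Sum>l = 0..k. v l + v (Suc l)) = v 0 + (v (Suc k) :: form)"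
  by (induction k) (simp_all add: add.assoc)

text \<open>The differentials of the summands telescope in characteristic 2, and both end terms
  contain a repeated factor: \<open>e m\<close> in \<open>v 0\<close>, \<open>e 1\<close> in
  \<open>v (m - 1)\<close>. The bound on \<open>m\<close> keeps the largest index
  \<open>2 * m - 1\<close> within \<open>n\<close>.\<close>

lemma F_e_in_cocycles:
  assumes "2 \<le> m" "2 * m \<le> n + 1"
  shows "F (e m) m \<in> cocycles n 2"
proof -
  define v where "v l = e 1 \<and>\<^sub>e (e (m - l) \<and>\<^sub>e e (m + l))" for l
  have "e (m - l) \<and>\<^sub>e e (m + 1 + l) \<in> Lam n 2" if "l \<in> {0..m - 2}" for l
    using that assms unfolding e_wedge_e by (auto simp: zero_in_Lam intro!: mono_in_Lam)
  then have Lam: "F (e m) m \<in> Lam n 2"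
    unfolding F_e_e[OF assms(1)] by (intro sum_in_Lam)
  have "diff (e (m - l) \<and>\<^sub>e e (m + 1 + l)) = v l + v (Suc l)" if "l \<in> {0..m - 2}" for l
  proof -
    have "3 \<le> m + 1 + l" using assms by simp
    then have "e (m - l) \<and>\<^sub>e diff (e (m + 1 + l)) = v l"
      by (simp add: diff_e v_def wedge_left_commute[of "e (m - l)"])
    moreover have "diff (e (m - l)) \<and>\<^sub>e e (m + 1 + l) = v (Suc l)"
    proof (cases "3 \<le> m - l")
      case True
      then show ?thesis by (simp add: diff_e v_def wedge_assoc)
    next
      case False
      \<comment> \<open>Here \<open>m - l = 2\<close>: the left side is 0 since
        \<open>diff (e 2) = 0\<close>, and \<open>v (Suc l)\<close> is 0 since it contains
        \<open>e 1\<close> twice.\<close>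
      then have "m - Suc l = 1" using that assms(1) by auto
      then show ?thesis using False by (simp add: diff_e v_def flip: wedge_assoc)
    qed
    ultimately show ?thesis
      by (simp add: diff_e_wedge_e add.commute)
  qed
  then have "diff (F (e m) m) = (\<Sum>l = 0..m - 2. v l + v (Suc l))"
    unfolding F_e_e[OF assms(1)] diff_sum by (intro sum.cong refl)
  also have "\<dots> = v 0 + v (Suc (m - 2))"
    by (rule sum_add_Suc_form)
  also have "v 0 = 0" by (simp add: v_def)
  also have "v (Suc (m - 2)) = 0"
  proof -
    have "m - Suc (m - 2) = 1" using assms(1) by simp
    then show ?thesis by (simp add: v_def flip: wedge_assoc)
  qed
  finally show ?thesis using Lam by (simp add: cocycles_def)
qed

lemma e_1_wedge_e_in_cocycles:
  assumes "2 \<le> n"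
  shows "e 1 \<and>\<^sub>e e n \<in> cocycles n 2"
proof -
  have "e 1 \<and>\<^sub>e e n \<in> Lam n 2"
    using assms unfolding e_wedge_e by (auto intro!: mono_in_Lam)
  moreover have "diff (e 1 \<and>\<^sub>e e n) = e 1 \<and>\<^sub>e diff (e n)"
    by (simp add: diff_e_wedge_e diff_e)
  ultimately show ?thesis
    by (simp add: cocycles_def diff_e flip: wedge_assoc)
qed

section \<open>Generators of the second cohomology\<close>

text \<open>The family \<open>F (e m) m\<close> starts at \<open>m = 2\<close>; placing
  \<open>e 1 \<and>\<^sub>e e n\<close> at index 1 makes \<open>{1..(n + 1) div 2}\<close> the index
  set, whose size is the Betti number.\<close>

definition gens :: "nat \<Rightarrow> nat \<Rightarrow> form" where
  "gens n m = (if m = 1 then e 1 \<and>\<^sub>e e n else F (e m) m)"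

lemma gens_in_cocycles:
  assumes "3 \<le> n" "m \<in> {1..(n + 1) div 2}"
  shows "gens n m \<in> cocycles n 2"
proof (cases "m = 1")
  case True
  then show ?thesis using assms e_1_wedge_e_in_cocycles[of n] by (simp add: gens_def)
next
  case False
  then show ?thesis using assms F_e_in_cocycles[of m n] by (auto simp: gens_def)
qed

text \<open>The generators have pairwise disjoint sets of keys, so at most one term of the sum
  contributes at \<open>{k, l}\<close>.\<close>

lemma lookup_sum_gens:
  assumes "1 \<le> k" "k < l" "l \<le> n"
  shows "lookup (\<Sum>m\<in>{1..(n + 1) div 2}. scal (c m) (gens n m)) {k, l} =
    (if k = 1 then if l = n then c 1 else 0
     else if odd (k + l) \<and> k + l \<le> n + 2 then c ((k + l) div 2) else 0)"
proof -
  let ?A = "{1..(n + 1) div 2}"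
  \<comment> \<open>\<open>?h\<close> is the index of the only generator that may contain
    \<open>{k, l}\<close>, and \<open>?b\<close> decides whether its pattern does.\<close>
  let ?h = "if k = 1 then 1 else (k + l) div 2"
  let ?b = "if k = 1 then l = n else odd (k + l)"
  have "c m * lookup (gens n m) {k, l} = (if m = ?h then if ?b then c m else 0 else 0)"
    if "m \<in> ?A" for m
  proof (cases "m = 1")
    case True
    have "{1, n} = {k, l} \<longleftrightarrow> k = 1 \<and> l = n"
      using assms by (auto simp: doubleton_eq_iff)
    moreover have "2 \<le> (k + l) div 2" if "k \<noteq> 1"
      using that assms by linarith
    ultimately show ?thesis
      using True assms by (auto simp: gens_def e_wedge_e lookup_emon)
  next
    case False
    then have eq: "lookup (gens n m) {k, l} = (if 2 \<le> k \<and> k + l = 2 * m + 1 then 1 else 0)"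
      using that assms(2) lookup_F_e[of m k l] by (simp add: gens_def)
    show ?thesis
    proof (cases "k = 1")
      case True
      then show ?thesis unfolding eq using False by simp
    next
      case False
      then have "2 \<le> k \<and> k + l = 2 * m + 1 \<longleftrightarrow> m = (k + l) div 2 \<and> odd (k + l)"
        using assms(1) by presburger
      then show ?thesis
        unfolding eq using False by (simp only: if_False) simp
    qed
  qed
  then have "lookup (\<Sum>m\<in>?A. scal (c m) (gens n m)) {k, l}
      = (\<Sum>m\<in>?A. if m = ?h then if ?b then c m else 0 else 0)"
    unfolding lookup_sum lookup_scal by (intro sum.cong refl)
  also have "\<dots> = (if ?h \<in> ?A then if ?b then c ?h else 0 else 0)"
    by simp
  also have "\<dots> = (if k = 1 then if l = n then c 1 else 0
     else if odd (k + l) \<and> k + l \<le> n + 2 then c ((k + l) div 2) else 0)"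
  proof (cases "k = 1")
    case True
    moreover have "1 \<in> ?A" using assms by simp
    ultimately show ?thesis by simp
  next
    case k: False
    show ?thesis
    proof (cases "odd (k + l)")
      case True
      then obtain m where m: "k + l = 2 * m + 1" by (rule oddE)
      then have "(k + l) div 2 = m" by simp
      \<comment> \<open>The last index of \<open>gens\<close> corresponds exactly to the last
        antidiagonal that starts inside the index range.\<close>
      moreover have "m \<in> ?A \<longleftrightarrow> k + l \<le> n + 2"
        unfolding atLeastAtMost_iff using m assms by linarith
      ultimately show ?thesis
        using k True by (simp only: if_True if_False simp_thms)
    next
      case False
      then show ?thesis using k by (simp only: if_False simp_thms if_cancel)
    qed
  qed
  finally show ?thesis .
qed

text \<open>A suitable combination of generators cancels \<open>\<omega>\<close> at
  \<open>{1, n}\<close> and at every key without 1. What remains is supported on the keys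
  \<open>{1, j}\<close> with \<open>j < n\<close>, hence is a coboundary.\<close>

lemma cocycle_2_cohomologous:
  assumes "3 \<le> n" "\<omega> \<in> cocycles n 2"
  shows "\<exists>c. \<omega> + (\<Sum>m\<in>{1..(n + 1) div 2}. scal (c m) (gens n m)) \<in> coboundaries n 2"
proof -
  \<comment> \<open>Each coefficient is read off at one key of its generator: \<open>{1, n}\<close>,
    or the first entry \<open>{2, 2 * m - 1}\<close> of the antidiagonal
    \<open>2 * m + 1\<close>.\<close>
  define c where "c m = (if m = 1 then lookup \<omega> {1, n} else lookup \<omega> {2, 2 * m - 1})" for m
  let ?\<eta> = "\<omega> + (\<Sum>m\<in>{1..(n + 1) div 2}. scal (c m) (gens n m))"
  have "?\<eta> \<in> cocycles n 2"
    using assms by (intro add_in_cocycles sum_in_cocycles scal_in_cocycles gens_in_cocycles)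
  then have \<eta>: "?\<eta> \<in> Lam n 2" by (simp add: cocycles_def)
  have "?\<eta> \<in> coboundaries n 2"
  proof (rule coboundary_2I)
    fix I assume nz: "lookup ?\<eta> I \<noteq> 0"
    then have "I \<subseteq> {1..n}" "card I = 2"
      using lookup_eq_0_Lam[OF \<eta>] by blast+
    then obtain k l where kl: "I = {k, l}" "1 \<le> k" "k < l" "l \<le> n"
      by (auto simp: card_2_iff) (metis insert_commute linorder_neqE_nat)
    have eq: "lookup ?\<eta> I = lookup \<omega> {k, l} +
      (if k = 1 then if l = n then c 1 else 0
       else if odd (k + l) \<and> k + l \<le> n + 2 then c ((k + l) div 2) else 0)"
      unfolding lookup_add kl(1) lookup_sum_gens[OF kl(2-4)] ..
    have "k = 1"
    proof (rule ccontr)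
      assume k: "k \<noteq> 1"
      show False
      proof (cases "odd (k + l) \<and> k + l \<le> n + 2")
        case True
        then obtain m where m: "k + l = 2 * m + 1" by (blast elim: oddE)
        then have "(k + l) div 2 = m" "k + l - 2 = 2 * m - 1" "m \<noteq> 1"
          using k kl(2,3) by auto
        then have "c ((k + l) div 2) = lookup \<omega> {k, l}"
          using lookup_cocycle_2_antidiagonal[OF assms(2), of k l] k kl(2,3) by (simp add: c_def)
        then show False using nz unfolding eq if_not_P[OF k] if_P[OF True] by simp
      next
        case False
        then have "lookup \<omega> {k, l} = 0"
          using k kl(2,3) by (intro lookup_cocycle_2_eq_0[OF assms(2)]) auto
        then show False using nz unfolding eq if_not_P[OF k] if_not_P[OF False] by simp
      qed
    qed
    moreover from this have "l \<noteq> n"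
      using nz unfolding eq by (auto simp: c_def)
    ultimately show "\<exists>j. 2 \<le> j \<and> j < n \<and> I = {1, j}"
      using kl by (intro exI[of _ l]) simp
  qed
  then show ?thesis by blast
qed

text \<open>Coboundaries vanish at \<open>{1, n}\<close> and at every key without 1. Evaluating the
  combination at \<open>{1, n}\<close> and at \<open>{2, 2 * m - 1}\<close> therefore isolates each
  coefficient.\<close>

lemma gens_independent:
  assumes "3 \<le> n" "(\<Sum>m\<in>{1..(n + 1) div 2}. scal (c m) (gens n m)) \<in> coboundaries n 2"
  shows "\<forall>m\<in>{1..(n + 1) div 2}. c m = 0"
proof
  fix m assume m: "m \<in> {1..(n + 1) div 2}"
  show "c m = 0"
  proof (cases "m = 1")
    case True
    have "lookup (\<Sum>m\<in>{1..(n + 1) div 2}. scal (c m) (gens n m)) {1, n} = 0"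
    proof (rule ccontr)
      assume "\<not> ?thesis"
      then obtain j where "j < n" "{1, n} = {1, j}"
        by (rule lookup_coboundary_2[OF assms(2)])
      then show False by (auto simp: doubleton_eq_iff)
    qed
    then show ?thesis
      using True assms(1) lookup_sum_gens[of 1 n n c] by simp
  next
    case False
    have "lookup (\<Sum>m\<in>{1..(n + 1) div 2}. scal (c m) (gens n m)) {2, 2 * m - 1} = 0"
    proof (rule ccontr)
      assume "\<not> ?thesis"
      then obtain j where "{2, 2 * m - 1} = {1, j}"
        by (rule lookup_coboundary_2[OF assms(2)])
      then have "2 * m - 1 = 1" by (auto simp: doubleton_eq_iff)
      then show False using False m by simp
    qed
    moreover have "odd (2 + (2 * m - 1))" "2 + (2 * m - 1) \<le> n + 2" "(2 + (2 * m - 1)) div 2 = m"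
      "2 < 2 * m - 1" "2 * m - 1 \<le> n"
      using False m by auto
    ultimately show ?thesis
      using lookup_sum_gens[of 2 "2 * m - 1" n c] by simp
  qed
qed

section \<open>The first and second cohomology\<close>

theorem proposition1:
  fixes n :: nat
  assumes "n \<ge> 3"
  shows "{e 1, e 2} \<subseteq> cocycles n 1
    \<and> LinearCombinations.module.span Z2 (H n 1) {cls n 1 (e 1), cls n 1 (e 2)} = carrier (H n 1)
    \<and> betti n 1 = 2
    \<and> (\<forall>i. 2 \<le> i \<and> real i \<le> (real n + 1) / 2 \<longrightarrow>
          F (e i) i = (\<Sum>l = 0..i - 2. e (i - l) \<and>\<^sub>e e (i + 1 + l)))
    \<and> insert (e 1 \<and>\<^sub>e e n) {F (e i) i | i. 2 \<le> i \<and> real i \<le> (real n + 1) / 2} \<subseteq> cocycles n 2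
    \<and> LinearCombinations.module.span Z2 (H n 2)
          (cls n 2 ` insert (e 1 \<and>\<^sub>e e n) {F (e i) i | i. 2 \<le> i \<and> real i \<le> (real n + 1) / 2})
        = carrier (H n 2)
    \<and> int (betti n 2) = \<lfloor>(real n + 1) / 2\<rfloor>"
proof -
  let ?A = "{1..(n + 1) div 2}"
  let ?S = "insert (e 1 \<and>\<^sub>e e n) {F (e i) i | i. 2 \<le> i \<and> real i \<le> (real n + 1) / 2}"
  have e_cocycle: "e i \<in> cocycles n 1" if "i \<in> {1, 2}" for i
  proof -
    have "e i \<in> Lam n 1"
      unfolding e_def using that assms by (intro mono_in_Lam) auto
    then show ?thesis using that by (auto simp: cocycles_def diff_e)
  qed
  \<comment> \<open>Turns the rational bound of the statement into the index range of
    \<open>gens\<close>.\<close>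
  have le_iff: "real i \<le> (real n + 1) / 2 \<longleftrightarrow> i \<le> (n + 1) div 2" for i
  proof -
    have "real i \<le> (real n + 1) / 2 \<longleftrightarrow> real (2 * i) \<le> real (n + 1)"
      by (simp add: field_simps)
    also have "\<dots> \<longleftrightarrow> i \<le> (n + 1) div 2"
      unfolding of_nat_le_iff by linarith
    finally show ?thesis .
  qed
  have S: "?S = gens n ` ?A"
  proof -
    have "?A = insert 1 {2..(n + 1) div 2}" using assms by auto
    then have "gens n ` ?A = insert (gens n 1) (gens n ` {2..(n + 1) div 2})" by simp
    also have "\<dots> = ?S" unfolding le_iff by (auto simp: gens_def)
    finally show ?thesis ..
  qed
  have gen: "\<exists>c. \<omega> + (\<Sum>i\<in>{1, 2}. scal (c i) (e i)) \<in> coboundaries n 1"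
    if "\<omega> \<in> cocycles n 1" for \<omega>
  proof
    \<comment> \<open>As 0 is the only coboundary of degree 1, the combination must be
      \<open>\<omega>\<close> itself.\<close>
    show "\<omega> + (\<Sum>i\<in>{1, 2}. scal (lookup \<omega> {i}) (e i)) \<in> coboundaries n 1"
      using cocycle_1_eq[OF that] form_add_self[of \<omega>] unfolding coboundaries_1 by simp
  qed
  have indep: "\<forall>i\<in>{1, 2}. c i = 0"
    if "(\<Sum>i\<in>{1, 2}. scal (c i) (e i)) \<in> coboundaries n 1" for c
  proof
    fix i :: nat assume i: "i \<in> {1, 2}"
    have "lookup (\<Sum>i\<in>{1, 2}. scal (c i) (e i)) {i} = 0"
      using that unfolding coboundaries_1 by simp
    then show "c i = 0" using i by (auto simp: lookup_add e_def lookup_emon)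
  qed
  have "finite {1, 2::nat}" "e ` {1, 2} \<subseteq> cocycles n 1"
    using e_cocycle by blast+
  note H1 = H_basisI[of "{1, 2}" e n 1, OF this gen indep]
  have "finite ?A" "gens n ` ?A \<subseteq> cocycles n 2"
    using gens_in_cocycles[OF assms] by blast+
  note H2 = H_basisI[of ?A "gens n" n 2,
      OF this cocycle_2_cohomologous[OF assms] gens_independent[OF assms]]
  have "\<lfloor>(real n + 1) / 2\<rfloor> = int ((n + 1) div 2)"
    using floor_divide_of_nat_eq[where ?'a = real, of "n + 1" 2] by (simp add: add.commute)
  moreover have "?S \<subseteq> cocycles n 2"
    unfolding S using gens_in_cocycles[OF assms] by blast
  moreover have "\<forall>i. 2 \<le> i \<and> real i \<le> (real n + 1) / 2 \<longrightarrow>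
      F (e i) i = (\<Sum>l = 0..i - 2. e (i - l) \<and>\<^sub>e e (i + 1 + l))"
    using F_e_e by blast
  ultimately show ?thesis
    using e_cocycle H1 H2 unfolding S by simp
qed

end
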